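(* For every integer $n\ge 2$ let $Q_n(x)=-\int_x^1 L_{n-1}(t)\,dt$, where $L_{n-1}$ is the Legendre polynomial of degree $n-1$ normalized by $L_{n-1}(1)=1$. Then the polynomials $Q_n$ are orthogonal on $[-1,1]$ with respect to the weight function $w(x)=\frac{1}{1-x^2}$, that is, for all integers $n,m\ge 2$ with $n\neq m$, $$\int_{-1}^{1}\frac{Q_n(x)Q_m(x)}{1-x^2}\,dx=0,$$ and for every integer $n\ge 2$, $$\|Q_n\|^2:=\int_{-1}^{1}\frac{Q_n(x)^2}{1-x^2}\,dx=\frac{2}{n(n-1)(2n-1)}.$$
   Context: The Legendre polynomials are $L_n(x)=\frac{1}{2^n n!}\frac{d^n}{dx^n}(x^2-1)^n$, so that $L_n(1)=1$ for all $n\ge 0$. For $n\ge 2$ the polynomial $Q_n$ has degree $n$ and vanishes at $x=\pm1$. *)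

theory Defs
  imports "HOL-Analysis.Analysis" "HOL-Computational_Algebra.Polynomial"
begin

definition legendre_poly :: "nat \<Rightarrow> real poly" where
  "legendre_poly n = smult (1 / (2 ^ n * fact n)) ((pderiv ^^ n) ([:-1, 0, 1:] ^ n))"

text \<open>
  The interval integral is oriented, so \<open>Q_fun n\<close> is a polynomial function on the whole
  real line, not only for \<open>x \<le> 1\<close>. Only indices \<open>n \<ge> 2\<close> are meaningful.
\<close>

definition Q_fun :: "nat \<Rightarrow> real \<Rightarrow> real" where
  "Q_fun n x = - (LBINT t=ereal x..ereal 1. poly (legendre_poly (n - 1)) t)"

end

theory Submission
  imports Defs
begin

text \<open>
  Put \<open>k = n - 1\<close>. Legendre's equation \<open>((x\<^sup>2 - 1) L\<^sub>k')' = k (k + 1) L\<^sub>k\<close> identifies \<open>Q\<^sub>n\<close> with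
  \<open>(x\<^sup>2 - 1) L\<^sub>k' / (k (k + 1))\<close>, so the weight cancels one factor and an integration by parts
  gives \<open>\<integral> Q\<^sub>n Q\<^sub>m / (1 - x\<^sup>2) = (\<integral> L\<^sub>n\<^sub>-\<^sub>1 L\<^sub>m\<^sub>-\<^sub>1) / (n (n - 1))\<close>. By Rodrigues' formula and repeated
  integration by parts, \<open>L\<^sub>k\<close> is orthogonal to all polynomials of lower degree. For the norm,
  \<open>x L\<^sub>k' - k L\<^sub>k\<close> has degree below \<open>k\<close>, hence
  \<open>2 = [x L\<^sub>k\<^sup>2] = \<integral> L\<^sub>k\<^sup>2 + 2 \<integral> x L\<^sub>k L\<^sub>k' = (2 k + 1) \<integral> L\<^sub>k\<^sup>2\<close>.
\<close>

subsection \<open>Iterated derivatives of polynomials\<close>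

lemma degree_funpow_pderiv:
  fixes p :: "'a::{comm_semiring_1,semiring_no_zero_divisors,semiring_char_0} poly"
  shows "degree ((pderiv ^^ k) p) = degree p - k"
  by (induction k) (auto simp: degree_pderiv)

lemma funpow_pderiv_eq_0:
  fixes p :: "'a::{comm_semiring_1,semiring_no_zero_divisors,semiring_char_0} poly"
  assumes "degree p < k"
  shows "(pderiv ^^ k) p = 0"
proof -
  obtain j where j: "k = Suc j" using assms by (cases k) auto
  have "degree ((pderiv ^^ j) p) = 0"
    using assms j by (simp add: degree_funpow_pderiv)
  then show ?thesis by (simp add: j pderiv_eq_0_iff)
qed

text \<open>Differentiation keeps the shape "power of \<open>x - a\<close> times a cofactor" and
  lowers the exponent by one, so the inductions below can run over all cofactors \<open>q\<close>.
  At \<open>a\<close> the new cofactor has the value \<open>(m + 1) * q(a)\<close>; these factors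
  build up \<open>fact m\<close>.\<close>

lemma pderiv_linear_power_mult:
  fixes q :: "'a::idom poly"
  shows "pderiv ([:- a, 1:] ^ Suc m * q) =
         [:- a, 1:] ^ m * (smult (of_nat (Suc m)) q + [:- a, 1:] * pderiv q)"
proof -
  have "pderiv ([:- a, 1:] ^ Suc m) = smult (of_nat (Suc m)) ([:- a, 1:] ^ m)"
    unfolding pderiv_power_Suc by (simp add: pderiv_pCons)
  then show ?thesis
    by (simp only: pderiv_mult) (simp add: algebra_simps)
qed

lemma poly_funpow_pderiv_linear_power_mult:
  fixes q :: "'a::{idom,semiring_char_0} poly"
  shows "poly ((pderiv ^^ m) ([:- a, 1:] ^ m * q)) a = fact m * poly q a"
proof (induction m arbitrary: q)
  case (Suc m)
  then show ?case
    by (simp only: funpow_Suc_right o_apply pderiv_linear_power_mult) (simp add: algebra_simps)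
qed simp

lemma poly_funpow_pderiv_linear_power_mult_eq_0:
  fixes q :: "'a::idom poly"
  assumes "j < m"
  shows "poly ((pderiv ^^ j) ([:- a, 1:] ^ m * q)) a = 0"
  using assms
proof (induction j arbitrary: m q)
  case 0
  then show ?case by simp
next
  case (Suc j)
  then obtain i where "m = Suc i" "j < i" by (cases m) auto
  with Suc.IH show ?case
    by (simp only: funpow_Suc_right o_apply pderiv_linear_power_mult)
qed

subsection \<open>Integrals of polynomials over \<open>[-1, 1]\<close>\<close>

lemma has_integral_poly_pderiv:
  fixes p :: "real poly"
  shows "(poly (pderiv p) has_integral (poly p 1 - poly p (-1))) {-1..1}"
  by (rule fundamental_theorem_of_calculus)
     (auto simp: has_real_derivative_iff_has_vector_derivative[symmetric]
           intro: DERIV_subset[OF poly_DERIV])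

lemma poly_integrable_on [simp]:
  fixes p :: "real poly"
  shows "poly p integrable_on {a..b}"
  by (intro integrable_continuous_interval continuous_intros)

lemma integral_poly_add:
  fixes p q :: "real poly"
  shows "integral {a..b} (poly (p + q)) = integral {a..b} (poly p) + integral {a..b} (poly q)"
proof -
  have "poly (p + q) = (\<lambda>x. poly p x + poly q x)" by (rule ext) simp
  then show ?thesis using integral_add[of "poly p" "{a..b}" "poly q"] by simp
qed

lemma integral_poly_smult:
  fixes p :: "real poly"
  shows "integral {a..b} (poly (smult c p)) = c * integral {a..b} (poly p)"
proof -
  have "poly (smult c p) = (\<lambda>x. c * poly p x)" by (rule ext) simp
  then show ?thesis by simp
qed

lemma integral_poly_by_parts:
  fixes p q :: "real poly"
  shows "integral {-1..1} (poly (pderiv p * q)) =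
         poly p 1 * poly q 1 - poly p (-1) * poly q (-1) - integral {-1..1} (poly (p * pderiv q))"
proof -
  have "poly p 1 * poly q 1 - poly p (-1) * poly q (-1) = integral {-1..1} (poly (pderiv (p * q)))"
    using integral_unique[OF has_integral_poly_pderiv[of "p * q"]] by simp
  also have "pderiv (p * q) = pderiv p * q + p * pderiv q"
    by (simp add: pderiv_mult algebra_simps)
  finally show ?thesis by (simp only: integral_poly_add)
qed

text \<open>Each integration by parts moves one derivative from \<open>u\<close> to
  \<open>q\<close>; the zeros of \<open>u\<close> at both endpoints remove the boundary
  terms.\<close>

lemma integral_funpow_pderiv_mult_eq_0:
  fixes u q :: "real poly"
  assumes "\<And>j. j < k \<Longrightarrow> poly ((pderiv ^^ j) u) 1 = 0"
    and "\<And>j. j < k \<Longrightarrow> poly ((pderiv ^^ j) u) (-1) = 0"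
    and "(pderiv ^^ k) q = 0"
  shows "integral {-1..1} (poly ((pderiv ^^ k) u * q)) = 0"
  using assms
proof (induction k arbitrary: q)
  case (Suc k)
  have "integral {-1..1} (poly ((pderiv ^^ k) u * pderiv q)) = 0"
    using Suc.prems by (intro Suc.IH) (auto simp: funpow_Suc_right simp del: funpow.simps)
  then show ?case
    using Suc.prems(1,2)[of k] integral_poly_by_parts[of "(pderiv ^^ k) u" q]
    by (simp only: funpow.simps o_apply)
qed (use integral_poly_smult[of "-1" 1 0 0] in simp)

subsection \<open>Legendre polynomials\<close>

text \<open>Exposes the zeros of order \<open>k\<close> at 1 and -1; \<open>- (- 1)\<close> matches
  the pattern \<open>[:- a, 1:]\<close> at \<open>a = -1\<close>.\<close>

lemma square_minus_one_power:
  "[:-1, 0, 1::real:] ^ k = [:- 1, 1:] ^ k * [:1, 1:] ^ k"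
  "[:-1, 0, 1::real:] ^ k = [:- (- 1), 1:] ^ k * [:- 1, 1:] ^ k"
  by (simp_all add: power_mult_distrib[symmetric])

lemma poly_legendre_poly_1: "poly (legendre_poly k) 1 = 1"
  unfolding legendre_poly_def square_minus_one_power(1)
  by (simp only: poly_smult poly_funpow_pderiv_linear_power_mult) (simp add: poly_power)

lemma poly_legendre_poly_minus_1: "poly (legendre_poly k) (-1) = (-1) ^ k"
  unfolding legendre_poly_def square_minus_one_power(2)
  by (simp only: poly_smult poly_funpow_pderiv_linear_power_mult)
     (simp add: poly_power power_minus[of 2])

lemma degree_legendre_poly: "degree (legendre_poly k) = k"
  by (simp add: legendre_poly_def degree_funpow_pderiv degree_power_eq)

lemma integral_legendre_poly_mult_eq_0:
  assumes "degree q < k"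
  shows "integral {-1..1} (poly (legendre_poly k * q)) = 0"
proof -
  have "integral {-1..1} (poly ((pderiv ^^ k) ([:-1, 0, 1:] ^ k) * q)) = 0"
  proof (rule integral_funpow_pderiv_mult_eq_0)
    show "poly ((pderiv ^^ j) ([:-1, 0, 1:] ^ k)) (1::real) = 0" if "j < k" for j
      unfolding square_minus_one_power(1)
      by (rule poly_funpow_pderiv_linear_power_mult_eq_0[OF that])
    show "poly ((pderiv ^^ j) ([:-1, 0, 1:] ^ k)) (-1::real) = 0" if "j < k" for j
      unfolding square_minus_one_power(2)
      by (rule poly_funpow_pderiv_linear_power_mult_eq_0[OF that])
  qed (rule funpow_pderiv_eq_0[OF assms])
  then show ?thesis
    by (simp only: legendre_poly_def mult_smult_left integral_poly_smult mult_zero_right)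
qed

lemma integral_legendre_poly_orthogonal:
  assumes "k \<noteq> j"
  shows "integral {-1..1} (poly (legendre_poly k * legendre_poly j)) = 0"
  using assms
\<comment> \<open>By symmetry \<open>k < j\<close>, so \<open>legendre_poly k\<close> serves as the
  factor of lower degree.\<close>
proof (induction k j rule: linorder_wlog)
  case (le k j)
  then show ?case
    using integral_legendre_poly_mult_eq_0[of "legendre_poly k" j]
    by (simp only: degree_legendre_poly mult.commute)
next
  case (sym k j)
  then show ?case by (simp only: mult.commute)
qed

section \<open>The norm of the Legendre polynomials\<close>

lemma degree_euler_operator_less:
  fixes p :: "real poly"
  assumes "degree p \<le> k" "k > 0"
  shows "degree ([:0, 1:] * pderiv p - smult (real k) p) < k"
proof -
  have "coeff ([:0, 1:] * pderiv p - smult (real k) p) i = 0" if "k - 1 < i" for i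
  proof -
    obtain l where l: "i = Suc l" using \<open>k - 1 < i\<close> by (cases i) auto
    \<comment> \<open>The operator multiplies the coefficient of \<open>x^i\<close> by
      \<open>i - k\<close>, which cancels at \<open>i = k\<close>; beyond that \<open>p\<close> has
      no coefficients.\<close>
    have "i = k \<or> coeff p i = 0" using that assms by (auto intro: coeff_eq_0)
    then show ?thesis by (auto simp: l coeff_pderiv)
  qed
  then have "degree ([:0, 1:] * pderiv p - smult (real k) p) \<le> k - 1"
    by (intro degree_le) blast
  then show ?thesis using assms(2) by linarith
qed

lemma integral_legendre_poly_square:
  assumes "k > 0"
  shows "integral {-1..1} (poly (legendre_poly k * legendre_poly k)) = 2 / (2 * real k + 1)"
proof -
  define L where "L = legendre_poly k"
  define r where "r = [:0, 1:] * pderiv L - smult (real k) L"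
  let ?I = "integral {-1..1} (poly (L * L))"
  have "degree r < k"
    unfolding r_def L_def using assms by (intro degree_euler_operator_less) (auto simp: degree_legendre_poly)
  then have r0: "integral {-1..1} (poly (L * r)) = 0"
    unfolding L_def by (rule integral_legendre_poly_mult_eq_0)
  \<comment> \<open>Substitute \<open>x L' = r + k L\<close> into
    \<open>(x L^2)' = L^2 + 2 x L L'\<close>.\<close>
  have "pderiv ([:0, 1:] * L * L) = smult (1 + 2 * real k) (L * L) + smult 2 (L * r)"
    unfolding r_def by (simp add: pderiv_mult pderiv_pCons poly_eq_poly_eq_iff[symmetric] fun_eq_iff algebra_simps)
  then have "integral {-1..1} (poly (pderiv ([:0, 1:] * L * L))) = (1 + 2 * real k) * ?I"
    using r0 by (simp only: integral_poly_add integral_poly_smult)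
  moreover have "integral {-1..1} (poly (pderiv ([:0, 1:] * L * L))) = 2"
    using integral_unique[OF has_integral_poly_pderiv[of "[:0, 1:] * L * L"]]
    by (simp add: L_def poly_legendre_poly_1 poly_legendre_poly_minus_1 flip: power_add)
  ultimately show ?thesis by (simp add: L_def field_simps)
qed

section \<open>Legendre's differential equation\<close>

lemma pderiv_square_minus_one_power:
  "[:-1, 0, 1:] * pderiv ([:-1, 0, 1:] ^ k) = smult (2 * real k) ([:0, 1:] * [:-1, 0, 1:] ^ k)"
proof (cases k)
  case (Suc j)
  have "pderiv [:-1, 0, 1::real:] = smult 2 [:0, 1:]" by (simp add: pderiv_pCons)
  then show ?thesis unfolding Suc pderiv_power_Suc by (simp add: poly_eq_poly_eq_iff[symmetric] fun_eq_iff algebra_simps)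
qed simp

text \<open>This is \<open>(x^2 - 1) u' - 2 k x u = 0\<close> differentiated \<open>m + 1\<close>
  times; the coefficients are those of Leibniz' rule, and each induction step differentiates once
  more.\<close>

lemma funpow_pderiv_square_minus_one_power_recurrence:
  fixes k :: nat
  defines "u \<equiv> [:-1, 0, 1::real:] ^ k"
  shows "[:-1, 0, 1:] * (pderiv ^^ Suc (Suc m)) u
       + smult (2 * (real m + 1 - real k)) ([:0, 1:] * (pderiv ^^ Suc m) u)
       + smult ((real m + 1) * (real m - 2 * real k)) ((pderiv ^^ m) u) = 0"
proof (induction m)
  case 0
  have "pderiv ([:-1, 0, 1:] * pderiv u) = pderiv (smult (2 * real k) ([:0, 1:] * u))"
    unfolding u_def pderiv_square_minus_one_power ..
  then show ?case
    by (simp add: pderiv_mult pderiv_smult pderiv_diff pderiv_pCons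
        poly_eq_poly_eq_iff[symmetric] fun_eq_iff algebra_simps)
next
  case (Suc m)
  from arg_cong[where f = pderiv, OF Suc] show ?case
    by (simp add: pderiv_mult pderiv_smult pderiv_add pderiv_diff pderiv_pCons
        poly_eq_poly_eq_iff[symmetric] fun_eq_iff algebra_simps)
qed

lemma legendre_poly_differential_equation:
  "pderiv ([:-1, 0, 1:] * pderiv (legendre_poly k)) = smult (real k * (real k + 1)) (legendre_poly k)"
proof -
  let ?v = "(pderiv ^^ k) ([:-1, 0, 1::real:] ^ k)"
  have "pderiv ([:-1, 0, 1:] * pderiv ?v) = smult (real k * (real k + 1)) ?v"
    \<comment> \<open>At \<open>m = k\<close> the coefficients become 2 and
      \<open>- k (k + 1)\<close>, and \<open>(x^2 - 1) v'' + 2 x v'\<close> is the derivative of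
      \<open>(x^2 - 1) v'\<close>.\<close>
    using funpow_pderiv_square_minus_one_power_recurrence[of k k]
    by (simp add: pderiv_mult pderiv_diff pderiv_pCons
        poly_eq_poly_eq_iff[symmetric] fun_eq_iff algebra_simps)
  then show ?thesis
    unfolding legendre_poly_def pderiv_smult mult_smult_right
    by (simp only: smult_smult mult.commute)
qed

subsection \<open>The polynomials \<open>Q\<^sub>n\<close>\<close>

definition Q_poly :: "nat \<Rightarrow> real poly" where
  "Q_poly n = smult (1 / (real n * (real n - 1))) ([:-1, 0, 1:] * pderiv (legendre_poly (n - 1)))"

lemma pderiv_Q_poly:
  assumes "n \<ge> 2"
  shows "pderiv (Q_poly n) = legendre_poly (n - 1)"
  using assms
  by (simp only: Q_poly_def pderiv_smult legendre_poly_differential_equation) (simp add: of_nat_diff)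

lemma poly_Q_poly_1: "poly (Q_poly n) 1 = 0"
  and poly_Q_poly_minus_1: "poly (Q_poly n) (-1) = 0"
  by (simp_all add: Q_poly_def)

text \<open>\<open>Q_poly n\<close> is the antiderivative of \<open>legendre_poly (n - 1)\<close>
  that vanishes at 1.\<close>

lemma Q_fun_eq_poly:
  assumes "n \<ge> 2"
  shows "Q_fun n x = poly (Q_poly n) x"
proof -
  have "(LBINT t=ereal x..ereal 1. poly (legendre_poly (n - 1)) t) = poly (Q_poly n) 1 - poly (Q_poly n) x"
  proof (rule interval_integral_FTC_finite)
    show "(poly (Q_poly n) has_vector_derivative poly (legendre_poly (n - 1)) t)
            (at t within {min x 1..max x 1})" for t
      using DERIV_subset[OF poly_DERIV[of "Q_poly n" t]]
      by (simp add: pderiv_Q_poly[OF assms] has_real_derivative_iff_has_vector_derivative[symmetric])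
  qed (intro continuous_intros)
  then show ?thesis by (simp add: Q_fun_def poly_Q_poly_1)
qed

lemma Q_fun_product_has_integral:
  assumes "n \<ge> 2" "m \<ge> 2"
  shows "((\<lambda>x. Q_fun n x * Q_fun m x / (1 - x\<^sup>2)) has_integral
           integral {-1..1} (poly (legendre_poly (n - 1) * legendre_poly (m - 1))) / (real n * (real n - 1)))
         {-1..1}"
proof -
  define c where "c = 1 / (real n * (real n - 1))"
  \<comment> \<open>The integrand after cancelling the weight against the factor
    \<open>x^2 - 1\<close> of \<open>Q_poly n\<close>, whence the sign. Integration by parts then
    turns \<open>Q_poly m\<close> into \<open>legendre_poly (m - 1)\<close>, without boundary
    terms.\<close>
  define p where "p = smult (- c) (pderiv (legendre_poly (n - 1)) * Q_poly m)"
  have "integral {-1..1} (poly p) = c * integral {-1..1} (poly (legendre_poly (n - 1) * legendre_poly (m - 1)))"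
    using integral_poly_by_parts[of "legendre_poly (n - 1)" "Q_poly m"]
    by (simp only: p_def integral_poly_smult pderiv_Q_poly[OF assms(2)] poly_Q_poly_1 poly_Q_poly_minus_1) simp
  moreover have "Q_fun n x * Q_fun m x / (1 - x\<^sup>2) = poly p x" for x
  proof (cases "x\<^sup>2 = 1")
    \<comment> \<open>At \<open>x = \<plusminus>1\<close> the left-hand side is a division by zero, and both sides are \<open>0\<close>.\<close>
    case True
    then have "x = 1 \<or> x = -1" by (simp add: power2_eq_1_iff)
    then show ?thesis by (auto simp: p_def poly_Q_poly_1 poly_Q_poly_minus_1)
  next
    case False
    have "poly (Q_poly n) x = (1 - x\<^sup>2) * (- c * poly (pderiv (legendre_poly (n - 1))) x)"
      by (simp add: Q_poly_def c_def power2_eq_square algebra_simps diff_divide_distrib)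
    with False show ?thesis
      by (simp add: Q_fun_eq_poly assms p_def)
  qed
  ultimately show ?thesis
    using integrable_integral[OF poly_integrable_on[of p "-1" 1]] by (simp add: c_def)
qed

theorem proposition1:
  shows "(\<forall>n m :: nat. n \<ge> 2 \<longrightarrow> m \<ge> 2 \<longrightarrow> n \<noteq> m \<longrightarrow>
            ((\<lambda>x::real. Q_fun n x * Q_fun m x / (1 - x\<^sup>2)) has_integral 0) {-1..1})
       \<and> (\<forall>n :: nat. n \<ge> 2 \<longrightarrow>
            ((\<lambda>x::real. (Q_fun n x)\<^sup>2 / (1 - x\<^sup>2)) has_integral
               2 / (real n * (real n - 1) * (2 * real n - 1))) {-1..1})"
proof (intro conjI allI impI)
  fix n m :: nat
  assume "n \<ge> 2" "m \<ge> 2" "n \<noteq> m"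
  then show "((\<lambda>x::real. Q_fun n x * Q_fun m x / (1 - x\<^sup>2)) has_integral 0) {-1..1}"
    using Q_fun_product_has_integral[of n m] integral_legendre_poly_orthogonal[of "n - 1" "m - 1"]
    by (simp only:) auto
next
  fix n :: nat
  assume n: "n \<ge> 2"
  \<comment> \<open>With \<open>k = n - 1 > 0\<close>, the denominator \<open>2 k + 1\<close> is
    \<open>2 n - 1\<close>.\<close>
  have "integral {-1..1} (poly (legendre_poly (n - 1) * legendre_poly (n - 1))) = 2 / (2 * real n - 1)"
    using integral_legendre_poly_square[of "n - 1"] n by (simp only: of_nat_diff) (auto simp: algebra_simps)
  then show "((\<lambda>x::real. (Q_fun n x)\<^sup>2 / (1 - x\<^sup>2)) has_integral
               2 / (real n * (real n - 1) * (2 * real n - 1))) {-1..1}"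
    using Q_fun_product_has_integral[OF n n] by (simp only: power2_eq_square divide_divide_eq_left mult_ac)
qed

end
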